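(* Let $\Omega\subseteq\mathbb{R}^n$ be a bounded open set and let $\mathcal N\subseteq\mathbb{R}^\ell$ be a compact set. Let $j:\mathbb{R}^n\to[0,+\infty]$ be a Borel-measurable kernel such that (i) $j(-z)=j(z)$ for all $z\in\mathbb{R}^n$; (ii) $\int_{\mathbb{R}^n}\min\{1,|z|^2\}\,j(z)\,dz<+\infty$; (iii) $j\notin L^1(B_R)$ for every $R>0$. Let $\Lambda\ge 1$, let $\psi:\mathcal N\times\mathcal N\to[0,+\infty)$ be a Borel-measurable function with $$\frac1\Lambda|p-q|^2\le\psi(p,q)\le\Lambda|p-q|^2\quad\text{for all }p,q\in\mathcal N,$$ and let $K:\Omega\times\Omega\to[0,+\infty]$ be a measurable kernel with $$\frac1\Lambda\, j(x-y)\le K(x,y)\quad\text{for a.e. }x,y\in\Omega.$$ Let $(m_k)_{k\in\mathbb{N}}\subseteq\mathcal X^K(\Omega;\mathcal N)$ be such that $$\sup_{k\in\mathbb{N}}\mathcal F_\Omega(m_k)<+\infty.$$ Then there exist a subsequence $(m_{k_h})_h$ and a function $m\in\mathcal X^K(\Omega;\mathcal N)$ such that $$\lim_{h\to\infty}\|m_{k_h}-m\|_{L^2(\Omega;\mathbb{R}^\ell)}=0.$$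
   Context: $B_R$ is the ball of radius $R$ centered at the origin of $\mathbb{R}^n$. $L^2(\Omega;\mathcal N):=\{m\in L^2(\Omega;\mathbb{R}^\ell): m\in\mathcal N\text{ a.e. in }\Omega\}$. For $m\in L^2(\Omega;\mathcal N)$ set $$\mathcal K_\Omega(m):=\iint_{\Omega\times\Omega}K(x,y)|m(x)-m(y)|^2\,dx\,dy,\qquad \mathcal F_\Omega(m):=\iint_{\Omega\times\Omega}K(x,y)\,\psi(m(x),m(y))\,dx\,dy,$$ with the usual convention $0\cdot\infty=0$, and $\mathcal X^K(\Omega;\mathcal N):=\{m\in L^2(\Omega;\mathcal N):\mathcal K_\Omega(m)<+\infty\}$. *)

theory Defs
  imports "HOL-Analysis.Analysis"
begin

text \<open>
  Elements of \<open>L\<^sup>2\<close> are represented by functions rather than by classes modulo null sets, and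
  functions on \<open>\<Omega>\<close> by total functions whose values outside \<open>\<Omega>\<close> are irrelevant. The functionals
  below depend on \<open>m\<close> only up to null sets of \<open>\<Omega>\<close>. Double integrals are taken with respect to
  Lebesgue measure on the product space; the product on \<^typ>\<open>ennreal\<close> satisfies \<open>0 * \<infinity> = 0\<close>.
\<close>

definition L2_maps ::
    "(real^'n) set \<Rightarrow> (real^'l) set \<Rightarrow> (real^'n \<Rightarrow> real^'l) set" where
  "L2_maps \<Omega> N =
     {m \<in> borel_measurable (lebesgue_on \<Omega>).
        integrable (lebesgue_on \<Omega>) (\<lambda>x. (norm (m x))\<^sup>2) \<and>
        (AE x in lebesgue_on \<Omega>. m x \<in> N)}"

definition L2_norm_on :: "(real^'n) set \<Rightarrow> (real^'n \<Rightarrow> real^'l) \<Rightarrow> real" where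
  "L2_norm_on \<Omega> f = sqrt (\<integral>x. (norm (f x))\<^sup>2 \<partial>lebesgue_on \<Omega>)"

definition K_energy ::
    "(real^'n) set \<Rightarrow> (real^'n \<Rightarrow> real^'n \<Rightarrow> ennreal) \<Rightarrow> (real^'n \<Rightarrow> real^'l) \<Rightarrow> ennreal" where
  "K_energy \<Omega> K m =
     (\<integral>\<^sup>+(x, y). K x y * ennreal ((norm (m x - m y))\<^sup>2) \<partial>lebesgue_on (\<Omega> \<times> \<Omega>))"

text \<open>
  Only the values of \<open>\<psi>\<close> on \<open>N \<times> N\<close> matter, since \<open>m\<close> lies in \<open>N\<close> almost everywhere.
\<close>

definition F_energy ::
    "(real^'n) set \<Rightarrow> (real^'n \<Rightarrow> real^'n \<Rightarrow> ennreal) \<Rightarrow> (real^'l \<Rightarrow> real^'l \<Rightarrow> real)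
      \<Rightarrow> (real^'n \<Rightarrow> real^'l) \<Rightarrow> ennreal" where
  "F_energy \<Omega> K \<psi> m =
     (\<integral>\<^sup>+(x, y). K x y * ennreal (\<psi> (m x) (m y)) \<partial>lebesgue_on (\<Omega> \<times> \<Omega>))"

definition X_space ::
    "(real^'n) set \<Rightarrow> (real^'n \<Rightarrow> real^'n \<Rightarrow> ennreal) \<Rightarrow> (real^'l) set
      \<Rightarrow> (real^'n \<Rightarrow> real^'l) set" where
  "X_space \<Omega> K N = {m \<in> L2_maps \<Omega> N. K_energy \<Omega> K m < \<infinity>}"

end

theory Submission
  imports Defs "HOL-Library.Diagonal_Subsequence"
begin

text \<open>
  The maps are uniformly bounded, so a subsequence converges weakly-* in \<open>L\<^sup>\<infinity>\<close>. Truncating \<open>j\<close> in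
  height and to a small ball gives an integrable kernel \<open>J \<le> j\<close> whose mass \<open>c\<close> is as large as we
  please, because \<open>j\<close> is not integrable near the origin. At points of a compact \<open>S \<subseteq> \<Omega>\<close> the ball
  stays inside \<open>\<Omega>\<close>, and the energy bound forces \<open>m\<close> to be \<open>L\<^sup>1(S)\<close>-close to its average
  \<open>(J * m) / c\<close>, uniformly along the sequence. These averages converge pointwise along the
  subsequence, since \<open>J(x - \<cdot>)\<close> is an \<open>L\<^sup>1\<close> test function. Hence the subsequence is Cauchy in
  \<open>L\<^sup>1(\<Omega>)\<close>, the part outside \<open>S\<close> being small by boundedness. A further subsequence converges almost
  everywhere; dominated convergence then gives \<open>L\<^sup>2\<close> convergence, and Fatou's lemma bounds the
  energy of the limit.
\<close>

lemma bounded_family_diagonal_subseq: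
  fixes a :: "nat \<Rightarrow> nat \<Rightarrow> 'b::heine_borel"
  assumes bdd: "\<And>i. bounded (range (a i))"
  obtains r :: "nat \<Rightarrow> nat" where "strict_mono r" "\<And>i. convergent (\<lambda>h. a i (r h))"
proof -
  interpret subseqs "\<lambda>i s. convergent (a i \<circ> s)"
  proof
    fix i and s :: "nat \<Rightarrow> nat"
    have "bounded (range (a i \<circ> s))"
      by (rule bounded_subset[OF bdd[of i]]) auto
    then obtain l r where "strict_mono r" "((a i \<circ> s) \<circ> r) \<longlonglongrightarrow> l"
      using bounded_imp_convergent_subsequence by blast
    then show "\<exists>r'. strict_mono r' \<and> convergent (a i \<circ> (s \<circ> r'))"
      by (auto simp: convergent_def o_assoc)
  qed
  have "convergent (\<lambda>h. a i (diagseq h))" for i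
  proof -
    have "convergent (a i \<circ> (diagseq \<circ> (+) (Suc i)))"
      by (rule diagseq_holds) (auto simp: o_assoc convergent_subseq_convergent)
    then have "convergent (\<lambda>h. a i (diagseq (h + Suc i)))"
      by (simp add: o_def add.commute)
    then show ?thesis
      by (rule convergent_ignore_initial_segment[of "\<lambda>h. a i (diagseq h)", THEN iffD1])
  qed
  with subseq_diagseq show ?thesis
    by (rule that)
qed

lemma countable_Int_stable_generator:
  obtains G :: "'a::second_countable_topology set set"
  where "countable G" "Int_stable G" "sets borel = sigma_sets UNIV G"
proof -
  obtain B :: "'a set set" where B: "countable B" "topological_basis B"
    using ex_countable_basis by blast
  define G where "G = Inter ` {F. finite F \<and> F \<subseteq> B}"
  have "countable G"
    unfolding G_def by (intro countable_image countable_Collect_finite_subset B)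
  have G_iff: "X \<in> G \<longleftrightarrow> (\<exists>F. finite F \<and> F \<subseteq> B \<and> X = \<Inter>F)" for X
    unfolding G_def image_iff by simp
  have "Int_stable G"
  proof (rule Int_stableI)
    fix X Y assume "X \<in> G" "Y \<in> G"
    then obtain F F' where F: "finite F" "F \<subseteq> B" "X = \<Inter>F"
      and F': "finite F'" "F' \<subseteq> B" "Y = \<Inter>F'"
      unfolding G_iff by (elim exE conjE) (rule that)
    have "finite (F \<union> F') \<and> F \<union> F' \<subseteq> B \<and> X \<inter> Y = \<Inter>(F \<union> F')"
      using F F' by (simp add: Inter_Un_distrib)
    then show "X \<inter> Y \<in> G"
      unfolding G_iff by (rule exI)
  qed
  have "sets borel = sigma_sets UNIV G"
  proof
    have "B \<subseteq> G"
    proof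
      fix b assume "b \<in> B"
      then have "finite {b} \<and> {b} \<subseteq> B \<and> b = \<Inter>{b}"
        by simp
      then show "b \<in> G"
        unfolding G_iff by (rule exI)
    qed
    then have "sigma_sets UNIV B \<subseteq> sigma_sets UNIV G"
      by (rule sigma_sets_mono')
    then show "sets borel \<subseteq> sigma_sets UNIV G"
      by (simp add: borel_eq_countable_basis[OF B])
    have "X \<in> sets borel" if "X \<in> G" for X
    proof -
      obtain F where F: "finite F" "F \<subseteq> B" "X = \<Inter>F"
        using \<open>X \<in> G\<close> unfolding G_iff by (elim exE conjE) (rule that)
      then have "open X"
        using topological_basis_open[OF B(2)] by (simp add: open_Inter subset_iff)
      then show ?thesis by simp
    qed
    then show "sigma_sets UNIV G \<subseteq> sets borel"
      by (rule sets.sigma_sets_subset[of G borel, unfolded space_borel, OF subsetI])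
  qed
  with \<open>countable G\<close> \<open>Int_stable G\<close> show ?thesis
    by (rule that)
qed

lemma integrable_scaleR_bounded:
  fixes f :: "'a \<Rightarrow> real" and u :: "'a \<Rightarrow> 'b::euclidean_space"
  assumes f: "integrable M f" and u: "u \<in> borel_measurable M" and bdd: "\<And>x. norm (u x) \<le> B"
  shows "integrable M (\<lambda>x. f x *\<^sub>R u x)"
proof (rule Bochner_Integration.integrable_bound)
  show "integrable M (\<lambda>x. B * f x)"
    using f by simp
  show "(\<lambda>x. f x *\<^sub>R u x) \<in> borel_measurable M"
    using borel_measurable_integrable[OF f] u by simp
  have "norm (f x *\<^sub>R u x) \<le> norm (B * f x)" for x
    using mult_left_mono[OF order_trans[OF bdd[of x] abs_ge_self], of "\<bar>f x\<bar>"]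
    by (simp add: abs_mult mult.commute)
  then show "AE x in M. norm (f x *\<^sub>R u x) \<le> norm (B * f x)"
    by simp
qed

lemma (in finite_measure) convergent_integral_closed:
  fixes u :: "nat \<Rightarrow> 'a \<Rightarrow> 'b::euclidean_space"
  assumes u[measurable]: "\<And>k. u k \<in> borel_measurable M"
    and bdd: "\<And>k x. norm (u k x) \<le> B"
    and f: "integrable M f" and g: "\<And>i. integrable M (g i)"
    and conv: "\<And>i. convergent (\<lambda>k. \<integral>x. g i x *\<^sub>R u k x \<partial>M)"
    and lim: "(\<lambda>i::nat. \<integral>x. norm (g i x - f x) \<partial>M) \<longlonglongrightarrow> (0::real)"
  shows "convergent (\<lambda>k. \<integral>x. f x *\<^sub>R u k x \<partial>M)"
proof -
  have int: "integrable M (\<lambda>x. h x *\<^sub>R u k x)" if "integrable M h" for h :: "'a \<Rightarrow> real" and k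
    using that u bdd by (rule integrable_scaleR_bounded)
  have diff: "norm ((\<integral>x. f x *\<^sub>R u k x \<partial>M) - (\<integral>x. g i x *\<^sub>R u k x \<partial>M))
      \<le> B * (\<integral>x. norm (g i x - f x) \<partial>M)" for i k
  proof -
    have "norm ((\<integral>x. f x *\<^sub>R u k x \<partial>M) - (\<integral>x. g i x *\<^sub>R u k x \<partial>M))
        = norm (\<integral>x. (f x - g i x) *\<^sub>R u k x \<partial>M)"
      by (simp add: scaleR_left_diff_distrib int f g)
    also have "\<dots> \<le> (\<integral>x. norm ((f x - g i x) *\<^sub>R u k x) \<partial>M)"
      by (rule integral_norm_bound)
    also have "\<dots> \<le> (\<integral>x. B * norm (g i x - f x) \<partial>M)"
      by (intro integral_mono integrable_norm int integrable_mult_right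
            Bochner_Integration.integrable_diff f g)
        (simp add: abs_minus_commute mult.commute mult_right_mono bdd)
    finally show ?thesis by simp
  qed
  show ?thesis
    unfolding Cauchy_convergent_iff[symmetric]
  proof (rule metric_CauchyI)
    fix e :: real assume e: "0 < e"
    have "(\<lambda>i. B * (\<integral>x. norm (g i x - f x) \<partial>M)) \<longlonglongrightarrow> B * 0"
      by (intro tendsto_intros lim)
    then have "\<forall>\<^sub>F i in sequentially. B * (\<integral>x. norm (g i x - f x) \<partial>M) < e / 3"
      by (rule order_tendstoD) (use e in simp)
    then obtain i where i: "B * (\<integral>x. norm (g i x - f x) \<partial>M) < e / 3"
      by (auto simp: eventually_sequentially)
    obtain k0 where k0: "dist (\<integral>x. g i x *\<^sub>R u k x \<partial>M) (\<integral>x. g i x *\<^sub>R u l x \<partial>M) < e / 3"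
      if "k \<ge> k0" "l \<ge> k0" for k l
      using metric_CauchyD[OF convergent_Cauchy[OF conv[of i]], of "e / 3"] e by auto
    have "dist (\<integral>x. f x *\<^sub>R u k x \<partial>M) (\<integral>x. f x *\<^sub>R u l x \<partial>M) < e" if "k \<ge> k0" "l \<ge> k0" for k l
    proof -
      have "dist (\<integral>x. f x *\<^sub>R u k x \<partial>M) (\<integral>x. g i x *\<^sub>R u k x \<partial>M) < e / 3" for k
        using diff[of k i] i by (simp add: dist_norm)
      from this[of k] k0[OF that] this[of l, unfolded dist_commute[of "\<integral>x. f x *\<^sub>R u l x \<partial>M"]]
      show ?thesis
        by (rule dist_triangle_third)
    qed
    then show "\<exists>M'. \<forall>m\<ge>M'. \<forall>n\<ge>M'. dist (\<integral>x. f x *\<^sub>R u m x \<partial>M) (\<integral>x. f x *\<^sub>R u n x \<partial>M) < e"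
      by blast
  qed
qed

text \<open>
  The sets \<open>X\<close> for which the integrals over \<open>X\<close> converge form a Dynkin system, so a diagonal
  argument over a countable generator suffices; no separability of \<open>L\<^sup>1\<close> is needed.
\<close>

lemma bounded_weak_star_subseq:
  fixes u :: "nat \<Rightarrow> 'a::second_countable_topology \<Rightarrow> 'b::euclidean_space"
  assumes "finite_measure M" and M: "sets M = sets borel"
    and u[measurable]: "\<And>k. u k \<in> borel_measurable M"
    and bdd: "\<And>k x. norm (u k x) \<le> B"
  obtains r :: "nat \<Rightarrow> nat" where "strict_mono r"
    "\<And>f. integrable M f \<Longrightarrow> convergent (\<lambda>h. \<integral>x. f x *\<^sub>R u (r h) x \<partial>M)"
proof -
  interpret finite_measure M by fact
  have space: "space M = UNIV"
    using sets_eq_imp_space_eq[OF M] by simp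
  obtain G0 :: "'a set set" where G0: "countable G0" "Int_stable G0" "sets borel = sigma_sets UNIV G0"
    by (rule countable_Int_stable_generator)
  define G where "G = insert UNIV G0"
  have cG: "countable G" "G \<noteq> {}"
    using G0(1) by (auto simp: G_def)
  have int_u: "integrable M (u k)" for k
    by (rule integrable_const_bound[of _ B]) (auto simp: bdd)
  define a where "a i k = (\<integral>x. indicat_real (from_nat_into G i) x *\<^sub>R u k x \<partial>M)" for i k
  have gen: "X \<in> sets M" if "X \<in> G" for X
  proof (cases "X = UNIV")
    case True
    then show ?thesis
      using sets.top[of M] space by simp
  next
    case False
    with that have "X \<in> sigma_sets UNIV G0"
      unfolding G_def by (intro sigma_sets.Basic) simp
    then show ?thesis
      by (simp only: M G0(3))
  qed
  have "bounded (range (a i))" for i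
  proof (rule boundedI)
    fix y assume "y \<in> range (a i)"
    then obtain k where y: "y = a i k" by blast
    define X where "X = from_nat_into G i"
    have X: "X \<in> sets M"
      unfolding X_def by (intro gen from_nat_into cG)
    have "norm y \<le> (\<integral>x. norm (indicat_real X x *\<^sub>R u k x) \<partial>M)"
      unfolding y a_def X_def by (rule integral_norm_bound)
    also have "\<dots> \<le> (\<integral>x. norm (u k x) \<partial>M)"
      by (intro integral_mono integrable_norm int_u integrable_mult_indicator X)
        (auto simp: indicator_def)
    also have "\<dots> \<le> (\<integral>x. B \<partial>M)"
      by (intro integral_mono integrable_norm int_u) (auto simp: bdd)
    finally show "norm y \<le> (\<integral>x. B \<partial>M)" .
  qed
  then obtain r where r: "strict_mono r" "\<And>i. convergent (\<lambda>h. a i (r h))"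
    using bounded_family_diagonal_subseq by metis
  have G: "convergent (\<lambda>h. \<integral>x. indicat_real X x *\<^sub>R u (r h) x \<partial>M)" if X: "X \<in> G" for X
  proof -
    obtain i where "X = from_nat_into G i"
      using from_nat_into_surj[OF cG(1) X] by blast
    then show ?thesis
      using r(2)[of i] by (simp add: a_def)
  qed
  have ind: "convergent (\<lambda>h. \<integral>x. indicat_real X x *\<^sub>R u (r h) x \<partial>M)" if "X \<in> sets M" for X
  proof -
    have "G0 \<subseteq> Pow UNIV" "X \<in> sigma_sets UNIV G0"
      using that by (simp_all add: M G0(3))
    with G0(2) show ?thesis
    proof (induction rule: sigma_sets_induct_disjoint)
      case (basic X)
      then show ?case by (intro G) (simp add: G_def)
    next
      case empty
      then show ?case by (simp add: convergent_const)
    next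
      case (compl X)
      have X: "X \<in> sets M"
        using compl by (simp add: M G0(3))
      have "convergent (\<lambda>h. (\<integral>x. indicat_real UNIV x *\<^sub>R u (r h) x \<partial>M)
          - (\<integral>x. indicat_real X x *\<^sub>R u (r h) x \<partial>M))"
        by (intro convergent_diff G compl) (simp add: G_def)
      moreover have "(\<integral>x. indicat_real (UNIV - X) x *\<^sub>R u k x \<partial>M)
          = (\<integral>x. indicat_real UNIV x *\<^sub>R u k x \<partial>M) - (\<integral>x. indicat_real X x *\<^sub>R u k x \<partial>M)" for k
      proof -
        have "(\<integral>x. indicat_real UNIV x *\<^sub>R u k x \<partial>M) - (\<integral>x. indicat_real X x *\<^sub>R u k x \<partial>M)
          = (\<integral>x. indicat_real UNIV x *\<^sub>R u k x - indicat_real X x *\<^sub>R u k x \<partial>M)"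
          by (intro Bochner_Integration.integral_diff[symmetric] integrable_mult_indicator X int_u)
            (use sets.top[of M] space in simp)
        also have "\<dots> = (\<integral>x. indicat_real (UNIV - X) x *\<^sub>R u k x \<partial>M)"
          by (intro Bochner_Integration.integral_cong) (auto simp: indicator_def)
        finally show ?thesis by simp
      qed
      ultimately show ?case by simp
    next
      case (union A)
      have A[measurable]: "A i \<in> sets M" for i
        using union(2) by (auto simp: M G0(3))
      define S where "S n = (\<Union>i<n. A i)" for n
      have S[measurable]: "S n \<in> sets M" for n
        unfolding S_def by measurable
      have UA[measurable]: "(\<Union>i. A i) \<in> sets M"
        by measurable
      have fin: "integrable M (indicat_real X)" if "X \<in> sets M" for X
        using that by (intro integrable_const_bound[of _ 1]) (auto simp: indicator_def)
      show ?case
      proof (rule convergent_integral_closed[of "\<lambda>h. u (r h)" B _ "\<lambda>n. indicator (S n)"])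
        show "convergent (\<lambda>h. \<integral>x. indicat_real (S n) x *\<^sub>R u (r h) x \<partial>M)" for n
        proof (induction n)
          case 0
          then show ?case by (simp add: S_def convergent_const)
        next
          case (Suc n)
          have "indicat_real (S (Suc n)) x = indicat_real (S n) x + indicat_real (A n) x" for x
          proof -
            have "A i \<inter> A n = {}" if "i < n" for i
              using disjoint_family_onD[OF union(1), of i n] that by simp
            then have "S n \<inter> A n = {}"
              by (auto simp: S_def)
            moreover have "S (Suc n) = S n \<union> A n"
              by (auto simp: S_def lessThan_Suc)
            ultimately show ?thesis
              by (auto simp: indicator_def)
          qed
          then have "(\<integral>x. indicat_real (S (Suc n)) x *\<^sub>R u k x \<partial>M)
              = (\<integral>x. indicat_real (S n) x *\<^sub>R u k x \<partial>M) + (\<integral>x. indicat_real (A n) x *\<^sub>R u k x \<partial>M)" for k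
            by (simp add: scaleR_left_distrib integrable_mult_indicator int_u)
          then show ?case
            using convergent_add[OF Suc union(3)[of n]] by simp
        qed
        have "(\<lambda>n. \<integral>x. norm (indicat_real (S n) x - indicat_real (\<Union>i. A i) x) \<partial>M)
            \<longlonglongrightarrow> (\<integral>x. 0 \<partial>M)"
        proof (rule integral_dominated_convergence[where w = "\<lambda>_. 1"])
          have "(\<lambda>n. indicat_real (S n) x) \<longlonglongrightarrow> indicat_real (\<Union>i. A i) x" for x
            unfolding S_def by (rule LIMSEQ_indicator_UN)
          then have "(\<lambda>n. norm (indicat_real (S n) x - indicat_real (\<Union>i. A i) x)) \<longlonglongrightarrow> 0" for x
            by (intro tendsto_norm_zero) (simp add: LIM_zero)
          then show "AE x in M. (\<lambda>n. norm (indicat_real (S n) x - indicat_real (\<Union>i. A i) x)) \<longlonglongrightarrow> 0"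
            by simp
        qed (auto simp: indicator_def)
        then show "(\<lambda>n. \<integral>x. norm (indicat_real (S n) x - indicat_real (\<Union>i. A i) x) \<partial>M) \<longlonglongrightarrow> 0"
          by simp
      qed (auto intro: bdd fin)
    qed
  qed
  have "convergent (\<lambda>h. \<integral>x. f x *\<^sub>R u (r h) x \<partial>M)" if "integrable M f" for f
    using that
  proof (induction rule: integrable_induct)
    case (base A c)
    have "convergent (\<lambda>h. c *\<^sub>R (\<integral>x. indicat_real A x *\<^sub>R u (r h) x \<partial>M))"
      using tendsto_scaleR[OF tendsto_const] ind[OF base(1)] unfolding convergent_def by blast
    then show ?case
      by (simp flip: integral_scaleR_right add: mult.commute)
  next
    case (add f g)
    have "integrable M (\<lambda>x. h x *\<^sub>R u k x)" if "integrable M h" for h :: "'a \<Rightarrow> real" and k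
      using that u bdd by (rule integrable_scaleR_bounded)
    then have "(\<integral>x. (f x + g x) *\<^sub>R u k x \<partial>M)
        = (\<integral>x. f x *\<^sub>R u k x \<partial>M) + (\<integral>x. g x *\<^sub>R u k x \<partial>M)" for k
      by (simp add: scaleR_left_distrib add)
    then show ?case
      using convergent_add[OF add.IH] by simp
  next
    case (lim f s)
    have [measurable]: "f \<in> borel_measurable M" "s i \<in> borel_measurable M" for i
      using lim by auto
    have "(\<lambda>i. \<integral>x. norm (s i x - f x) \<partial>M) \<longlonglongrightarrow> (\<integral>x. 0 \<partial>M)"
    proof (rule integral_dominated_convergence[where w = "\<lambda>x. 3 * norm (f x)"])
      show "AE x in M. (\<lambda>i. norm (s i x - f x)) \<longlonglongrightarrow> 0"
        using lim(2) by (intro AE_I2 tendsto_norm_zero LIM_zero) auto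
      have "norm (s i x - f x) \<le> 3 * norm (f x)" if "x \<in> space M" for i x
        using lim(3)[OF that, of i] norm_triangle_ineq4[of "s i x" "f x"] by linarith
      then show "AE x in M. norm (norm (s i x - f x)) \<le> 3 * norm (f x)" for i
        by simp
    qed (use lim in auto)
    then show ?case
      by (intro convergent_integral_closed[of "\<lambda>h. u (r h)" B f s]) (auto simp: lim bdd)
  qed
  with r(1) show ?thesis
    by (rule that)
qed

lemma L1_Cauchy_AE_subseq:
  fixes u :: "nat \<Rightarrow> 'a \<Rightarrow> 'b::{banach, second_countable_topology}"
  assumes u: "\<And>k. integrable M (u k)"
    and Cauchy: "\<And>e. 0 < e \<Longrightarrow> \<exists>k0. \<forall>k\<ge>k0. \<forall>l\<ge>k0. (\<integral>x. norm (u k x - u l x) \<partial>M) \<le> e"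
  obtains r :: "nat \<Rightarrow> nat" where "strict_mono r" "AE x in M. convergent (\<lambda>h. u (r h) x)"
proof -
  have [measurable]: "u k \<in> borel_measurable M" for k
    using u by auto
  have "\<forall>h. \<exists>k0. \<forall>k\<ge>k0. \<forall>l\<ge>k0. (\<integral>x. norm (u k x - u l x) \<partial>M) \<le> (1 / 2) ^ h"
    using Cauchy by simp
  then obtain \<kappa> where \<kappa>: "\<And>h k l. k \<ge> \<kappa> h \<Longrightarrow> l \<ge> \<kappa> h \<Longrightarrow> (\<integral>x. norm (u k x - u l x) \<partial>M) \<le> (1 / 2) ^ h"
    by metis
  define r where "r h = (\<Sum>i\<le>h. Suc (\<kappa> i))" for h
  have r: "strict_mono r"
    by (simp add: strict_mono_Suc_iff r_def)
  have r_ge: "\<kappa> h \<le> r h" for h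
    unfolding r_def by (cases h) auto
  define d where "d h x = u (r (Suc h)) x - u (r h) x" for h x
  have [measurable]: "d h \<in> borel_measurable M" for h
    unfolding d_def by measurable
  have d: "(\<integral>\<^sup>+x. ennreal (norm (d h x)) \<partial>M) \<le> ennreal ((1 / 2) ^ h)" for h
  proof -
    have "(\<integral>\<^sup>+x. ennreal (norm (d h x)) \<partial>M) = ennreal (\<integral>x. norm (d h x) \<partial>M)"
      unfolding d_def by (intro nn_integral_eq_integral integrable_norm Bochner_Integration.integrable_diff u) simp
    moreover have "r h \<le> r (Suc h)"
      by (simp add: strict_mono_less_eq[OF r])
    ultimately show ?thesis
      unfolding d_def using r_ge[of h] by (auto intro!: ennreal_leI \<kappa>)
  qed
  have "(\<integral>\<^sup>+x. (\<Sum>h. ennreal (norm (d h x))) \<partial>M) = (\<Sum>h. \<integral>\<^sup>+x. ennreal (norm (d h x)) \<partial>M)"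
    by (rule nn_integral_suminf) measurable
  also have "\<dots> \<le> (\<Sum>h. ennreal ((1 / 2) ^ h))"
    by (intro suminf_le d) auto
  also have "\<dots> < \<infinity>"
    by (subst suminf_ennreal2) (auto simp: summable_geometric)
  finally have "AE x in M. (\<Sum>h. ennreal (norm (d h x))) \<noteq> \<infinity>"
    by (intro nn_integral_noteq_infinite) auto
  then have "AE x in M. convergent (\<lambda>h. u (r h) x)"
  proof (rule eventually_mono)
    fix x assume "(\<Sum>h. ennreal (norm (d h x))) \<noteq> \<infinity>"
    then have "summable (\<lambda>h. norm (d h x))"
      by (intro summable_suminf_not_top) auto
    then have "convergent (\<lambda>n. \<Sum>h<n. d h x)"
      by (simp add: summable_norm_cancel flip: summable_iff_convergent)
    then have "convergent (\<lambda>n. u (r n) x - u (r 0) x)"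
      by (simp add: d_def sum_lessThan_telescope[of "\<lambda>h. u (r h) x"])
    then have "convergent (\<lambda>n. (u (r n) x - u (r 0) x) + u (r 0) x)"
      by (intro convergent_add convergent_const)
    then show "convergent (\<lambda>h. u (r h) x)" by simp
  qed
  with r show ?thesis by (rule that)
qed

lemma truncated_kernel:
  fixes j :: "'a::euclidean_space \<Rightarrow> ennreal"
  assumes [measurable]: "j \<in> borel_measurable borel"
    and inf: "(\<integral>\<^sup>+z\<in>ball 0 R. j z \<partial>lborel) = \<infinity>"
  obtains J :: "'a \<Rightarrow> real" and L where "J \<in> borel_measurable borel" "\<And>z. 0 \<le> J z" "\<And>z. J z \<le> L"
    "\<And>z. ennreal (J z) \<le> j z" "\<And>z. z \<notin> ball 0 R \<Longrightarrow> J z = 0"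
    "C < (\<integral>z. J z \<partial>lborel)"
proof -
  have [measurable]: "ball (0 :: 'a) R \<in> sets borel"
    by simp
  define T where "T n z = min (j z) (of_nat n) * indicator (ball 0 R) z" for n :: nat and z
  have [measurable]: "T n \<in> borel_measurable lborel" for n
    unfolding T_def by measurable
  have "(SUP n. min a (of_nat n)) = a" for a :: ennreal
    by (simp add: inf_min[symmetric] inf_SUP[symmetric] ennreal_SUP_of_nat_eq_top)
  then have "(SUP n. T n z) = j z * indicator (ball 0 R) z" for z
    unfolding T_def by (simp add: SUP_mult_right_ennreal[symmetric])
  then have "\<infinity> = (\<integral>\<^sup>+z. (SUP n. T n z) \<partial>lborel)"
    using inf by simp
  also have "\<dots> = (SUP n. \<integral>\<^sup>+z. T n z \<partial>lborel)"
  proof (rule nn_integral_monotone_convergence_SUP)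
    show "incseq T"
      unfolding T_def incseq_def le_fun_def
      by (intro allI impI mult_right_mono min.mono) auto
  qed measurable
  finally have "ennreal \<bar>C\<bar> < (SUP n. \<integral>\<^sup>+z. T n z \<partial>lborel)"
    by (metis ennreal_less_top infinity_ennreal_def)
  then obtain n where n: "ennreal \<bar>C\<bar> < (\<integral>\<^sup>+z. T n z \<partial>lborel)"
    unfolding less_SUP_iff by blast
  define J where "J z = enn2real (T n z)" for z
  have T_le: "T n z \<le> ennreal (real n)" for z
    unfolding T_def by (auto simp: indicator_def ennreal_of_nat_eq_real_of_nat)
  have eJ: "ennreal (J z) = T n z" for z
    unfolding J_def by (rule ennreal_enn2real[OF le_less_trans[OF T_le ennreal_less_top]])
  have J[measurable]: "J \<in> borel_measurable borel"
    unfolding J_def by measurable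
  have J_le: "J z \<le> real n" for z
    unfolding J_def using T_le[of z] by (simp add: enn2real_leI)
  have zero: "J z = 0" if "z \<notin> ball 0 R" for z
    using that by (simp add: J_def T_def)
  have J_ge: "0 \<le> J z" for z
    by (simp add: J_def)
  have int: "integrable lborel J"
  proof (rule Bochner_Integration.integrable_bound)
    show "integrable lborel (\<lambda>z. real n * indicat_real (ball 0 R :: 'a set) z)"
      by (intro integrable_mult_right integrable_real_indicator) (use emeasure_bounded_finite[OF bounded_ball[of "0 :: 'a" R]] in auto)
    show "AE z in lborel. norm (J z) \<le> norm (real n * indicat_real (ball 0 R) z)"
      using J_le J_ge zero by (auto simp: indicator_def)
  qed simp
  have "ennreal \<bar>C\<bar> < ennreal (\<integral>z. J z \<partial>lborel)"
    using n nn_integral_eq_integral[OF int] J_ge by (simp add: eJ)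
  then have C: "C < (\<integral>z. J z \<partial>lborel)"
    by (simp add: ennreal_less_iff)
  have "T n z \<le> j z" for z
    unfolding T_def by (auto simp: indicator_def)
  then have "ennreal (J z) \<le> j z" for z
    by (simp add: eJ)
  with J J_ge J_le zero C show ?thesis
    by (intro that[of J "real n"])
qed

lemma integral_average_deviation_le:
  fixes M :: "'a::{real_normed_vector, second_countable_topology} measure"
    and J :: "'a \<Rightarrow> real" and u :: "'a \<Rightarrow> 'b::euclidean_space"
  assumes "finite_measure M" and M[measurable_cong]: "sets M = sets borel"
    and J[measurable]: "J \<in> borel_measurable borel" and J_ge: "\<And>z. 0 \<le> J z" and J_le: "\<And>z. J z \<le> L"
    and u[measurable]: "u \<in> borel_measurable borel" and bdd: "\<And>x. norm (u x) \<le> B"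
    and c: "\<And>x. x \<in> S \<Longrightarrow> (\<integral>y. J (x - y) \<partial>M) = c" "0 \<le> c"
    and E: "(\<integral>\<^sup>+x. \<integral>\<^sup>+y. ennreal (J (x - y)) * ennreal ((norm (u x - u y))\<^sup>2) \<partial>M \<partial>M)
        \<le> ennreal E" "0 \<le> E"
    and \<epsilon>: "0 < \<epsilon>"
  shows "(\<integral>x. indicator S x * norm (c *\<^sub>R u x - (\<integral>y. J (x - y) *\<^sub>R u y \<partial>M)) \<partial>M)
    \<le> \<epsilon> * c * measure M UNIV + E / \<epsilon>"
proof -
  interpret finite_measure M by fact
  have space: "space M = UNIV"
    using sets_eq_imp_space_eq[OF M] by simp
  define I where "I x = (\<integral>\<^sup>+y. ennreal (J (x - y)) * ennreal ((norm (u x - u y))\<^sup>2) \<partial>M)" for x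
  have [measurable]: "I \<in> borel_measurable M"
    unfolding I_def by measurable
  have J_int: "integrable M (\<lambda>y. J (x - y))" for x
    by (rule integrable_const_bound[of _ L]) (auto simp: J_ge J_le)
  have Ju_int: "integrable M (\<lambda>y. J (x - y) *\<^sub>R u y)" for x
    by (rule integrable_scaleR_bounded[OF J_int _ bdd]) measurable
  have pt: "ennreal (norm (c *\<^sub>R u x - (\<integral>y. J (x - y) *\<^sub>R u y \<partial>M)))
      \<le> ennreal (\<epsilon> * c) + ennreal (1 / \<epsilon>) * I x"
    if x: "x \<in> S" for x
  proof -
    have int: "integrable M (\<lambda>y. J (x - y) *\<^sub>R u x)"
      using J_int by simp
    have "c *\<^sub>R u x - (\<integral>y. J (x - y) *\<^sub>R u y \<partial>M) = (\<integral>y. J (x - y) *\<^sub>R (u x - u y) \<partial>M)"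
      by (simp add: scaleR_right_diff_distrib int Ju_int J_int c(1)[OF x])
    then have "ennreal (norm (c *\<^sub>R u x - (\<integral>y. J (x - y) *\<^sub>R u y \<partial>M)))
        \<le> (\<integral>\<^sup>+y. norm (J (x - y) *\<^sub>R (u x - u y)) \<partial>M)"
      using integral_norm_bound_ennreal[of M "\<lambda>y. J (x - y) *\<^sub>R (u x - u y)"]
      by (simp add: scaleR_right_diff_distrib int Ju_int)
    also have "\<dots> \<le> (\<integral>\<^sup>+y. ennreal (\<epsilon> * J (x - y))
        + ennreal (1 / \<epsilon>) * (ennreal (J (x - y)) * ennreal ((norm (u x - u y))\<^sup>2)) \<partial>M)"
    proof (rule nn_integral_mono)
      fix y
      define t where "t = norm (u x - u y)"
      \<comment> \<open>This replaces the Cauchy-Schwarz inequality and gives an \<open>L\<^sup>1\<close> estimate directly.\<close>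
      have "t \<le> \<epsilon> + 1 / \<epsilon> * t\<^sup>2"
      proof (cases "t \<le> \<epsilon>")
        case True
        then show ?thesis using \<epsilon> by (simp add: add_increasing2)
      next
        case False
        then have "\<epsilon> * t \<le> t * t" using \<epsilon> by (intro mult_right_mono) auto
        then have "t \<le> 1 / \<epsilon> * t\<^sup>2" using \<epsilon> by (simp add: field_simps power2_eq_square)
        then show ?thesis using \<epsilon> by simp
      qed
      then have "J (x - y) * t \<le> J (x - y) * (\<epsilon> + 1 / \<epsilon> * t\<^sup>2)"
        by (rule mult_left_mono) (rule J_ge)
      then have "norm (J (x - y) *\<^sub>R (u x - u y)) \<le> \<epsilon> * J (x - y) + 1 / \<epsilon> * (J (x - y) * t\<^sup>2)"
        using J_ge[of "x - y"] by (simp add: distrib_left mult.commute mult.left_commute t_def del: scaleR_right_diff_distrib)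
      then have "ennreal (norm (J (x - y) *\<^sub>R (u x - u y)))
          \<le> ennreal (\<epsilon> * J (x - y) + 1 / \<epsilon> * (J (x - y) * t\<^sup>2))"
        by (rule ennreal_leI)
      also have "\<dots> = ennreal (\<epsilon> * J (x - y))
          + ennreal (1 / \<epsilon>) * (ennreal (J (x - y)) * ennreal (t\<^sup>2))"
        using J_ge[of "x - y"] \<epsilon> by (subst ennreal_plus) (auto simp: ennreal_mult[symmetric])
      finally show "ennreal (norm (J (x - y) *\<^sub>R (u x - u y)))
        \<le> ennreal (\<epsilon> * J (x - y))
            + ennreal (1 / \<epsilon>) * (ennreal (J (x - y)) * ennreal ((norm (u x - u y))\<^sup>2))"
        unfolding t_def .
    qed
    also have "\<dots> = (\<integral>\<^sup>+y. ennreal (\<epsilon> * J (x - y)) \<partial>M) + ennreal (1 / \<epsilon>) * I x"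
      unfolding I_def by (simp add: nn_integral_add nn_integral_cmult)
    also have "(\<integral>\<^sup>+y. ennreal (\<epsilon> * J (x - y)) \<partial>M) = ennreal (\<epsilon> * c)"
      using \<epsilon> J_ge by (subst nn_integral_eq_integral) (auto simp: J_int c(1)[OF x])
    finally show ?thesis .
  qed
  have "(\<integral>\<^sup>+x. ennreal (indicator S x * norm (c *\<^sub>R u x - (\<integral>y. J (x - y) *\<^sub>R u y \<partial>M))) \<partial>M)
      \<le> (\<integral>\<^sup>+x. ennreal (\<epsilon> * c) + ennreal (1 / \<epsilon>) * I x \<partial>M)"
    using pt by (intro nn_integral_mono) (auto simp: indicator_def)
  also have "\<dots> = ennreal (\<epsilon> * c) * emeasure M UNIV + ennreal (1 / \<epsilon>) * (\<integral>\<^sup>+x. I x \<partial>M)"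
    by (simp add: nn_integral_add nn_integral_cmult space)
  also have "\<dots> \<le> ennreal (\<epsilon> * c) * emeasure M UNIV + ennreal (1 / \<epsilon>) * ennreal E"
    using E(1) by (intro add_left_mono mult_left_mono) (auto simp: I_def)
  also have "\<dots> = ennreal (\<epsilon> * c * measure M UNIV + E / \<epsilon>)"
    using \<epsilon> c E by (simp add: emeasure_eq_measure ennreal_mult[symmetric])
  finally show ?thesis
    using \<epsilon> c E by (intro integral_real_bounded) auto
qed

lemma integral_reflected_kernel:
  fixes J :: "'a::euclidean_space \<Rightarrow> real"
  assumes [measurable]: "J \<in> borel_measurable borel" "\<Omega> \<in> sets borel"
    and zero: "\<And>z. z \<notin> ball 0 R \<Longrightarrow> J z = 0" and sub: "ball x R \<subseteq> \<Omega>"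
  shows "(\<integral>y. J (x - y) \<partial>density lborel (indicator \<Omega>)) = (\<integral>z. J z \<partial>lborel)"
proof -
  have "(\<integral>y. J (x - y) \<partial>density lborel (indicator \<Omega>))
      = (\<integral>y. indicat_real \<Omega> y *\<^sub>R J (x - y) \<partial>lborel)"
    by (subst integral_density[symmetric]) (auto simp: ennreal_indicator)
  also have "\<dots> = (\<integral>y. J (x - y) \<partial>lborel)"
  proof (rule Bochner_Integration.integral_cong)
    fix y
    show "indicat_real \<Omega> y *\<^sub>R J (x - y) = J (x - y)"
      using zero[of "x - y"] subsetD[OF sub, of y]
      by (auto simp: indicator_def dist_norm norm_minus_commute)
  qed simp
  also have "\<dots> = (\<integral>z. J z \<partial>lborel)"
  proof -
    have "lborel = distr lborel borel (\<lambda>y. x - y)"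
      using lborel_affine[of "-1" x] by (simp add: density_1)
    then have "(\<integral>z. J z \<partial>lborel) = (\<integral>z. J z \<partial>distr lborel borel (\<lambda>y. x - y))"
      by simp
    also have "\<dots> = (\<integral>y. J (x - y) \<partial>lborel)"
      by (rule integral_distr) simp_all
    finally show ?thesis by simp
  qed
  finally show ?thesis .
qed

lemma nonlocal_energy_AE_subseq:
  fixes \<Omega> :: "'a::euclidean_space set" and u :: "nat \<Rightarrow> 'a \<Rightarrow> 'b::euclidean_space"
  defines "M \<equiv> density lborel (indicator \<Omega>)"
  assumes \<Omega>: "bounded \<Omega>" "open \<Omega>"
    and j[measurable]: "j \<in> borel_measurable borel"
    and inf: "\<And>R. 0 < R \<Longrightarrow> (\<integral>\<^sup>+z\<in>ball 0 R. j z \<partial>lborel) = \<infinity>"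
    and u[measurable]: "\<And>k. u k \<in> borel_measurable borel" and bdd: "\<And>k x. norm (u k x) \<le> B"
    and E: "\<And>k. (\<integral>\<^sup>+x. \<integral>\<^sup>+y. j (x - y) * ennreal ((norm (u k x - u k y))\<^sup>2) \<partial>M \<partial>M) \<le> ennreal E"
  obtains r :: "nat \<Rightarrow> nat" where "strict_mono r" "AE x in M. convergent (\<lambda>h. u (r h) x)"
proof -
  have M[measurable_cong]: "sets M = sets borel"
    by (simp add: M_def)
  have space: "space M = UNIV"
    by (simp add: M_def)
  have \<Omega>_borel[measurable]: "\<Omega> \<in> sets borel"
    using \<Omega> by simp
  have emeasure_M: "emeasure M X = emeasure lborel (\<Omega> \<inter> X)" if "X \<in> sets borel" for X
    using that unfolding M_def by (subst emeasure_density) (auto simp flip: indicator_inter_arith)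
  have finite_M: "finite_measure M"
    by (rule finite_measureI) (use emeasure_bounded_finite[OF \<Omega>(1)] in \<open>simp add: space emeasure_M\<close>)
  then interpret finite_measure M .
  define m where "m = measure M UNIV"
  have m: "0 \<le> m"
    by (simp add: m_def)
  obtain r where r: "strict_mono r"
    and weak: "\<And>f. integrable M f \<Longrightarrow> convergent (\<lambda>h. \<integral>x. f x *\<^sub>R u (r h) x \<partial>M)"
    using bounded_weak_star_subseq[OF finite_M M, of u B] u bdd by auto
  define v where "v h = u (r h)" for h
  have v[measurable]: "v h \<in> borel_measurable borel" and v_bdd: "norm (v h x) \<le> B" for h x
    unfolding v_def by (auto simp: bdd)
  have v_int: "integrable M (v h)" for h
    by (rule integrable_const_bound[of _ B]) (auto simp: v_bdd)
  have B: "0 \<le> B"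
    using v_bdd[of 0 0] norm_ge_zero order_trans by blast
  have E': "(\<integral>\<^sup>+x. \<integral>\<^sup>+y. j (x - y) * ennreal ((norm (v k x - v k y))\<^sup>2) \<partial>M \<partial>M) \<le> ennreal \<bar>E\<bar>" for k
    unfolding v_def by (rule order_trans[OF E]) (simp add: ennreal_leI)
  have "\<exists>k0. \<forall>k\<ge>k0. \<forall>l\<ge>k0. (\<integral>x. norm (v k x - v l x) \<partial>M) \<le> e" if e: "0 < e" for e
  proof -
    obtain S where S: "compact S" "S \<subseteq> \<Omega>" "2 * B * measure M (- S) \<le> e / 4"
    proof -
      define \<delta> where "\<delta> = e / (8 * B + 1)"
      have \<delta>: "0 < \<delta>"
        using e B by (simp add: \<delta>_def)
      have "emeasure M \<Omega> = (SUP K\<in>{K. K \<subseteq> \<Omega> \<and> compact K}. emeasure M K)"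
        by (rule inner_regular) (auto simp: M emeasure_finite)
      moreover have "emeasure M \<Omega> = ennreal m"
        unfolding m_def by (simp add: emeasure_eq_measure[symmetric] emeasure_M)
      moreover have "ennreal (m - \<delta>) < ennreal m \<or> m \<le> 0"
        using \<delta> m by (cases "m = 0") (auto simp: ennreal_less_iff ennreal_lessI)
      ultimately have "ennreal (m - \<delta>) < (SUP K\<in>{K. K \<subseteq> \<Omega> \<and> compact K}. emeasure M K) \<or> m \<le> 0"
        by simp
      then consider (small) "m \<le> 0" | (big) K where "K \<subseteq> \<Omega>" "compact K" "ennreal (m - \<delta>) < emeasure M K"
        unfolding less_SUP_iff by auto
      then show ?thesis
      proof cases
        case small
        then have "measure M (- {}) = 0"
          using measure_nonneg[of M UNIV] unfolding m_def Compl_empty_eq by linarith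
        then show ?thesis
          using e by (intro that[of "{}"]) auto
      next
        case big
        have "m - \<delta> < measure M K"
          using big(3) unfolding emeasure_eq_measure by (meson ennreal_leI not_le)
        moreover have "measure M (- K) = m - measure M K"
          unfolding m_def using finite_measure_compl[of K] compact_imp_closed[OF big(2)]
          by (simp add: M space Compl_eq_Diff_UNIV borel_closed)
        ultimately have "2 * B * measure M (- K) \<le> 2 * B * \<delta>"
          using B by (intro mult_left_mono) auto
        also have "\<dots> \<le> e / 4"
          using B e by (simp add: \<delta>_def field_simps)
        finally show ?thesis
          using big by (intro that[of K])
      qed
    qed
    obtain R where R: "0 < R" "(\<Union>x\<in>S. ball x R) \<subseteq> \<Omega>"
      using compact_subset_open_imp_ball_epsilon_subset[OF S(1) \<Omega>(2) S(2)] by blast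
    have S_borel[measurable]: "S \<in> sets borel"
      using S(1) by (simp add: borel_compact)
    define \<epsilon> where "\<epsilon> = e / (16 * (m + 1))"
    have \<epsilon>: "0 < \<epsilon>"
      using e m by (simp add: \<epsilon>_def)
    obtain J L where J[measurable]: "J \<in> borel_measurable borel" and J_ge: "\<And>z. 0 \<le> J z"
      and J_le: "\<And>z. J z \<le> L" and J_j: "\<And>z. ennreal (J z) \<le> j z"
      and J_0: "\<And>z. z \<notin> ball 0 R \<Longrightarrow> J z = 0"
      and J_C: "16 * \<bar>E\<bar> / (\<epsilon> * e) < (\<integral>z. J z \<partial>lborel)"
      using truncated_kernel[OF j inf[OF R(1)], of "16 * \<bar>E\<bar> / (\<epsilon> * e)"] by metis
    define c where "c = (\<integral>z. J z \<partial>lborel)"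
    have c: "0 < c" "16 * \<bar>E\<bar> / (\<epsilon> * e) < c"
    proof -
      have "0 \<le> 16 * \<bar>E\<bar> / (\<epsilon> * e)"
        using \<epsilon> e by simp
      with J_C show "0 < c" "16 * \<bar>E\<bar> / (\<epsilon> * e) < c"
        unfolding c_def by linarith+
    qed
    have L: "0 \<le> L"
      using J_ge[of 0] J_le[of 0] by linarith
    define A where "A h x = (\<integral>y. J (x - y) *\<^sub>R v h y \<partial>M)" for h x
    have [measurable]: "A h \<in> borel_measurable borel" for h
      unfolding A_def by measurable
    have J_int: "integrable M (\<lambda>y. J (x - y))" for x
      by (rule integrable_const_bound[of _ L]) (auto simp: J_ge J_le)
    have A_bdd: "norm (A h x) \<le> L * B * m" for h x
    proof -
      have "norm (J (x - y) *\<^sub>R v h y) \<le> L * B" for y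
        using J_ge[of "x - y"] J_le[of "x - y"] v_bdd[of h y] by (simp add: mult_mono')
      then have "(\<integral>y. norm (J (x - y) *\<^sub>R v h y) \<partial>M) \<le> (\<integral>y. L * B \<partial>M)"
        by (intro integral_mono integrable_norm integrable_scaleR_bounded[OF J_int _ v_bdd]) auto
      then have "norm (A h x) \<le> (\<integral>y. L * B \<partial>M)"
        unfolding A_def by (rule order_trans[OF integral_norm_bound])
      then show ?thesis
        by (simp add: m_def space ac_simps)
    qed
    have A_int: "integrable M (A h)" for h
      by (rule integrable_const_bound[of _ "L * B * m"]) (auto simp: A_bdd)
    have deviation: "(\<integral>x. indicator S x * norm (c *\<^sub>R v h x - A h x) \<partial>M) \<le> c * (e / 8)" for h
    proof -
      have "(\<integral>x. indicator S x * norm (c *\<^sub>R v h x - A h x) \<partial>M) \<le> \<epsilon> * c * m + \<bar>E\<bar> / \<epsilon>"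
        unfolding A_def m_def
      proof (rule integral_average_deviation_le[OF finite_M M J J_ge J_le v v_bdd])
        show "(\<integral>y. J (x - y) \<partial>M) = c" if "x \<in> S" for x
          unfolding M_def c_def using that R(2) by (intro integral_reflected_kernel[OF J \<Omega>_borel J_0]) auto
        have "(\<integral>\<^sup>+x. \<integral>\<^sup>+y. ennreal (J (x - y)) * ennreal ((norm (v h x - v h y))\<^sup>2) \<partial>M \<partial>M)
          \<le> (\<integral>\<^sup>+x. \<integral>\<^sup>+y. j (x - y) * ennreal ((norm (v h x - v h y))\<^sup>2) \<partial>M \<partial>M)"
          by (intro nn_integral_mono mult_right_mono J_j) auto
        then show "(\<integral>\<^sup>+x. \<integral>\<^sup>+y. ennreal (J (x - y)) * ennreal ((norm (v h x - v h y))\<^sup>2) \<partial>M \<partial>M)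
          \<le> ennreal \<bar>E\<bar>"
          using E' by (rule order_trans)
      qed (use c \<epsilon> in auto)
      moreover have "\<epsilon> * c * m \<le> c * (e / 16)"
      proof -
        have "\<epsilon> * m \<le> \<epsilon> * (m + 1)"
          using \<epsilon> by simp
        also have "\<dots> = e / 16"
          using m by (simp add: \<epsilon>_def divide_simps)
        finally show ?thesis
          using mult_left_mono[of "\<epsilon> * m" "e / 16" c] c(1) by (simp add: mult.commute mult.left_commute)
      qed
      moreover have "\<bar>E\<bar> / \<epsilon> \<le> c * (e / 16)"
      proof -
        have "16 * \<bar>E\<bar> < c * (\<epsilon> * e)"
          using c(2) e \<epsilon> by (subst (asm) pos_divide_less_eq) auto
        then show ?thesis
          using \<epsilon> by (subst pos_divide_le_eq) (auto simp: mult.commute mult.left_commute)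
      qed
      ultimately show ?thesis by linarith
    qed
    obtain k0 where k0: "(\<integral>x. norm (A k x - A l x) \<partial>M) \<le> c * (e / 4)" if "k0 \<le> k" "k0 \<le> l" for k l
    proof -
      define A' where "A' x = lim (\<lambda>h. A h x)" for x
      have A': "(\<lambda>h. A h x) \<longlonglongrightarrow> A' x" for x
        using weak[OF J_int[of x]] unfolding A'_def A_def v_def by (simp add: convergent_LIMSEQ_iff)
      have [measurable]: "A' \<in> borel_measurable M"
        by (rule borel_measurable_LIMSEQ_metric[OF _ A']) measurable
      have A'_bdd: "norm (A' x) \<le> L * B * m" for x
        by (rule Lim_norm_ubound[OF _ A']) (auto simp: A_bdd)
      have A'_int: "integrable M A'"
        by (rule integrable_const_bound[of _ "L * B * m"]) (auto simp: A'_bdd)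
      have "(\<lambda>h. \<integral>x. norm (A h x - A' x) \<partial>M) \<longlonglongrightarrow> (\<integral>x. 0 \<partial>M)"
      proof (rule integral_dominated_convergence[where w = "\<lambda>_. 2 * (L * B * m)"])
        show "AE x in M. (\<lambda>h. norm (A h x - A' x)) \<longlonglongrightarrow> 0"
          using A' by (intro AE_I2 tendsto_norm_zero LIM_zero)
        have "norm (A h x - A' x) \<le> 2 * (L * B * m)" for h x
          using norm_triangle_ineq4[of "A h x" "A' x"] A_bdd[of h x] A'_bdd[of x] by linarith
        then show "AE x in M. norm (norm (A h x - A' x)) \<le> 2 * (L * B * m)" for h
          by simp
      qed auto
      then have "\<forall>\<^sub>F h in sequentially. (\<integral>x. norm (A h x - A' x) \<partial>M) < c * (e / 8)"
        using e c by (intro order_tendstoD) auto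
      then obtain k0 where k0: "(\<integral>x. norm (A h x - A' x) \<partial>M) < c * (e / 8)" if "k0 \<le> h" for h
        by (auto simp: eventually_sequentially)
      show ?thesis
      proof (rule that)
        fix k l assume kl: "k0 \<le> k" "k0 \<le> l"
        have "(\<integral>x. norm (A k x - A l x) \<partial>M) \<le> (\<integral>x. norm (A k x - A' x) + norm (A l x - A' x) \<partial>M)"
          by (intro integral_mono integrable_norm Bochner_Integration.integrable_add
                Bochner_Integration.integrable_diff A_int A'_int norm_diff_triangle_le[OF order_refl])
            (simp add: norm_minus_commute)
        also have "\<dots> = (\<integral>x. norm (A k x - A' x) \<partial>M) + (\<integral>x. norm (A l x - A' x) \<partial>M)"
          by (intro Bochner_Integration.integral_add integrable_norm
                Bochner_Integration.integrable_diff A_int A'_int)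
        finally show "(\<integral>x. norm (A k x - A l x) \<partial>M) \<le> c * (e / 4)"
          using k0[OF kl(1)] k0[OF kl(2)] by simp
      qed
    qed
    have "(\<integral>x. norm (v k x - v l x) \<partial>M) \<le> e" if kl: "k0 \<le> k" "k0 \<le> l" for k l
    proof -
      define D where "D h x = indicat_real S x * norm (c *\<^sub>R v h x - A h x)" for h x
      have D_bdd: "\<bar>D h x\<bar> \<le> c * B + L * B * m" for h x
      proof -
        have "norm (c *\<^sub>R v h x - A h x) \<le> c * B + L * B * m"
          using c(1) by (intro norm_triangle_le_diff add_mono A_bdd) (simp add: v_bdd)
        moreover have "\<bar>D h x\<bar> \<le> norm (c *\<^sub>R v h x - A h x)"
          by (cases "x \<in> S") (simp_all add: D_def)
        ultimately show ?thesis by linarith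
      qed
      have D_int: "integrable M (D h)" for h
        unfolding D_def
        by (rule integrable_const_bound[of _ "c * B + L * B * m"])
          (use D_bdd[unfolded D_def] in simp_all)
      have S_int: "integrable M (indicat_real (- S))"
        by (intro integrable_const_bound[of _ 1]) (auto simp: indicator_def)
      have pt: "c * norm (v k x - v l x) \<le> c * (2 * B) * indicat_real (- S) x
          + (D k x + D l x + norm (A k x - A l x))" for x
      proof (cases "x \<in> S")
        case True
        have "c * norm (v k x - v l x)
            = norm ((c *\<^sub>R v k x - A k x) - (c *\<^sub>R v l x - A l x) + (A k x - A l x))"
          using c by (simp add: scaleR_right_diff_distrib[symmetric])
        also have "\<dots> \<le> norm (c *\<^sub>R v k x - A k x) + norm (c *\<^sub>R v l x - A l x) + norm (A k x - A l x)"
          by (rule order_trans[OF norm_triangle_ineq add_right_mono[OF norm_triangle_ineq4]])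
        finally show ?thesis
          using True by (simp add: D_def)
      next
        case False
        have "norm (v k x - v l x) \<le> 2 * B"
          using norm_triangle_ineq4[of "v k x" "v l x"] v_bdd[of k x] v_bdd[of l x] by linarith
        then have "c * norm (v k x - v l x) \<le> c * (2 * B)"
          using c by simp
        then show ?thesis
          using False by (simp add: D_def add_increasing2)
      qed
      have "c * (\<integral>x. norm (v k x - v l x) \<partial>M) = (\<integral>x. c * norm (v k x - v l x) \<partial>M)"
        by simp
      also have "\<dots> \<le> (\<integral>x. c * (2 * B) * indicat_real (- S) x
          + (D k x + D l x + norm (A k x - A l x)) \<partial>M)"
        by (intro integral_mono pt Bochner_Integration.integrable_add integrable_mult_right
              integrable_norm Bochner_Integration.integrable_diff v_int A_int D_int S_int)
      also have "\<dots> = c * (2 * B) * (\<integral>x. indicat_real (- S) x \<partial>M)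
          + ((\<integral>x. D k x \<partial>M) + (\<integral>x. D l x \<partial>M) + (\<integral>x. norm (A k x - A l x) \<partial>M))"
        by (simp add: D_int S_int A_int)
      also have "\<dots> \<le> c * (e / 4) + (c * (e / 8) + c * (e / 8) + c * (e / 4))"
      proof (intro add_mono k0 kl)
        show "c * (2 * B) * (\<integral>x. indicat_real (- S) x \<partial>M) \<le> c * (e / 4)"
          using S(3) c by (simp add: space mult.assoc)
      qed (use deviation in \<open>auto simp: D_def\<close>)
      also have "\<dots> \<le> c * e"
        using c e by simp
      finally show ?thesis
        using c by simp
    qed
    then show ?thesis by blast
  qed
  then obtain r' where "strict_mono r'" "AE x in M. convergent (\<lambda>h. v (r' h) x)"
    by (rule L1_Cauchy_AE_subseq[OF v_int])
  then show ?thesis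
    using r by (intro that[of "r \<circ> r'"]) (auto simp: v_def strict_mono_o)
qed

lemma AE_lebesgue_on_iff:
  fixes A :: "'a::euclidean_space set"
  assumes "A \<in> sets borel"
  shows "(AE x in lebesgue_on A. P x) \<longleftrightarrow> (AE x in lborel. x \<in> A \<longrightarrow> P x)"
  using assms by (simp add: AE_restrict_space_iff AE_completion_iff)

lemma AE_lebesgue_on_Times:
  fixes A :: "'a::euclidean_space set"
  assumes A: "open A" and P: "AE x in lebesgue_on A. P x"
  shows "AE (x, y) in lebesgue_on (A \<times> A). P x \<and> P y"
proof -
  have "AE x in lborel. x \<in> A \<longrightarrow> P x"
    using P A by (simp add: AE_lebesgue_on_iff)
  then obtain N where N: "N \<in> null_sets lborel" "{x. \<not> (x \<in> A \<longrightarrow> P x)} \<subseteq> N"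
    unfolding eventually_ae_filter by auto
  have [measurable]: "N \<in> sets lborel"
    using N(1) by auto
  have meas: "{z \<in> space (lborel \<Otimes>\<^sub>M lborel). fst z \<notin> N \<and> snd z \<notin> N} \<in> sets (lborel \<Otimes>\<^sub>M lborel)"
    by measurable
  have N_AE: "AE x in lborel. x \<notin> N"
    using AE_not_in[OF N(1)] .
  then have "AE x in lborel. AE y in lborel. x \<notin> N \<and> y \<notin> N"
    by (auto elim!: eventually_mono)
  then have "AE z in lborel \<Otimes>\<^sub>M lborel. fst z \<notin> N \<and> snd z \<notin> N"
    by (intro lborel_pair.AE_pair_measure[OF meas]) simp
  then have "AE z in lborel. z \<in> A \<times> A \<longrightarrow> (case z of (x, y) \<Rightarrow> P x \<and> P y)"
    unfolding lborel_prod by (rule eventually_mono) (use N(2) in auto)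
  then show ?thesis
    using A by (subst AE_lebesgue_on_iff) (auto intro: borel_open open_Times)
qed

lemma nn_integral_lebesgue_on_Times:
  fixes A :: "'a::euclidean_space set" and f :: "'a \<Rightarrow> 'a \<Rightarrow> ennreal"
  assumes A: "open A" and f[measurable]: "(\<lambda>(x, y). f x y) \<in> borel_measurable borel"
  shows "(\<integral>\<^sup>+(x, y). f x y \<partial>lebesgue_on (A \<times> A))
    = (\<integral>\<^sup>+x. \<integral>\<^sup>+y. f x y \<partial>density lborel (indicator A) \<partial>density lborel (indicator A))"
proof -
  have [measurable]: "A \<in> sets borel" and AA: "A \<times> A \<in> sets borel"
    using A by (auto intro: borel_open open_Times)
  have f'[measurable]: "(\<lambda>(x, y). f x y) \<in> borel_measurable (lborel \<Otimes>\<^sub>M lborel)"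
    using f by (simp add: lborel_prod)
  have [measurable]: "(\<lambda>(x, y). f x y) \<in> borel_measurable (borel \<Otimes>\<^sub>M borel)"
    using f by (simp add: borel_prod)
  have "(\<integral>\<^sup>+(x, y). f x y \<partial>lebesgue_on (A \<times> A))
      = (\<integral>\<^sup>+z. (case z of (x, y) \<Rightarrow> f x y) * indicator (A \<times> A) z \<partial>lborel)"
    using AA by (simp add: nn_integral_restrict_space nn_integral_completion)
  also have "\<dots> = (\<integral>\<^sup>+z. (case z of (x, y) \<Rightarrow> indicator A x * (indicator A y * f x y)) \<partial>(lborel \<Otimes>\<^sub>M lborel))"
    unfolding lborel_prod by (intro nn_integral_cong) (auto simp: indicator_def)
  also have "\<dots> = (\<integral>\<^sup>+x. \<integral>\<^sup>+y. indicator A x * (indicator A y * f x y) \<partial>lborel \<partial>lborel)"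
    by (subst lborel.nn_integral_fst[symmetric]) auto
  also have "\<dots> = (\<integral>\<^sup>+x. indicator A x * (\<integral>\<^sup>+y. indicator A y * f x y \<partial>lborel) \<partial>lborel)"
    by (intro nn_integral_cong nn_integral_cmult) measurable
  also have "\<dots> = (\<integral>\<^sup>+x. \<integral>\<^sup>+y. f x y \<partial>density lborel (indicator A) \<partial>density lborel (indicator A))"
    by (simp add: nn_integral_density)
  finally show ?thesis .
qed

lemma lebesgue_on_borel_representative:
  fixes f :: "'a::euclidean_space \<Rightarrow> 'b::euclidean_space"
  assumes A: "A \<in> sets borel" and f: "f \<in> borel_measurable (lebesgue_on A)"
  obtains g where "g \<in> borel_measurable borel" "AE x in lebesgue_on A. f x = g x"
proof -
  have F: "(\<lambda>x. indicator A x *\<^sub>R f x) \<in> borel_measurable lebesgue"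
    using f A by (subst borel_measurable_restrict_space_iff[symmetric]) auto
  have "\<exists>g\<in>borel_measurable lborel. AE x in lborel. (indicator A x *\<^sub>R f x) \<bullet> i = g x" for i
    by (intro completion_ex_borel_measurable_real borel_measurable_inner F borel_measurable_const)
  then obtain g where g: "\<And>i. g i \<in> borel_measurable lborel"
    "\<And>i. AE x in lborel. (indicator A x *\<^sub>R f x) \<bullet> i = g i x"
    by metis
  define G where "G x = (\<Sum>i\<in>Basis. g i x *\<^sub>R i)" for x
  have "AE x in lborel. \<forall>i\<in>Basis. (indicator A x *\<^sub>R f x) \<bullet> i = g i x"
    using g(2) by (intro AE_finite_allI) auto
  then have "AE x in lborel. x \<in> A \<longrightarrow> f x = G x"
  proof (rule eventually_mono)
    fix x assume eq: "\<forall>i\<in>Basis. (indicator A x *\<^sub>R f x) \<bullet> i = g i x"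
    have "indicator A x *\<^sub>R f x = (\<Sum>i\<in>Basis. ((indicator A x *\<^sub>R f x) \<bullet> i) *\<^sub>R i)"
      by (rule euclidean_representation[symmetric])
    also have "\<dots> = G x"
      unfolding G_def by (intro sum.cong) (use eq in auto)
    finally show "x \<in> A \<longrightarrow> f x = G x"
      by auto
  qed
  moreover have "G \<in> borel_measurable borel"
    unfolding G_def using g(1) by simp
  ultimately show ?thesis
    using A by (intro that[of G]) (simp_all add: AE_lebesgue_on_iff)
qed

lemma cmult_le_liminf_ennreal:
  fixes f :: "nat \<Rightarrow> ennreal"
  assumes f: "f \<longlonglongrightarrow> a"
  shows "c * a \<le> liminf (\<lambda>n. c * f n)"
proof (cases "a = 0")
  case False
  have "(\<lambda>n. c * f n) \<longlonglongrightarrow> c * a"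
  proof (cases "c = top")
    case True
    have "\<forall>\<^sub>F n in sequentially. 0 < f n"
      using f False by (intro order_tendstoD) (auto simp: zero_less_iff_neq_zero)
    then have "\<forall>\<^sub>F n in sequentially. c * f n = c * a"
      by (rule eventually_mono) (use True False in \<open>auto simp: ennreal_top_mult\<close>)
    then show ?thesis
      by (rule tendsto_eventually)
  next
    case False
    then show ?thesis
      using f by (intro ennreal_tendsto_cmult) (auto simp: less_top)
  qed
  then show ?thesis
    by (simp add: lim_imp_Liminf)
qed simp

theorem theorem2p1:
  fixes \<Omega> :: "(real^'n) set"
    and N :: "(real^'l) set"
    and j :: "real^'n \<Rightarrow> ennreal"
    and \<Lambda> :: real
    and \<psi> :: "real^'l \<Rightarrow> real^'l \<Rightarrow> real"
    and K :: "real^'n \<Rightarrow> real^'n \<Rightarrow> ennreal"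
    and m_seq :: "nat \<Rightarrow> real^'n \<Rightarrow> real^'l"
  assumes "bounded \<Omega>" and "open \<Omega>"
    and "compact N"
    and "j \<in> borel_measurable borel"
    and "\<And>z. j (- z) = j z"
    and "(\<integral>\<^sup>+z. ennreal (min 1 ((norm z)\<^sup>2)) * j z \<partial>lborel) < \<infinity>"
    and "\<And>R. R > 0 \<Longrightarrow> (\<integral>\<^sup>+z\<in>ball 0 R. j z \<partial>lborel) = \<infinity>"
    and "\<Lambda> \<ge> 1"
    and "(\<lambda>(p, q). \<psi> p q) \<in> borel_measurable (restrict_space borel (N \<times> N))"
    and "\<And>p q. p \<in> N \<Longrightarrow> q \<in> N \<Longrightarrow> \<psi> p q \<ge> 0"
    and "\<And>p q. p \<in> N \<Longrightarrow> q \<in> N \<Longrightarrow>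
           1 / \<Lambda> * (norm (p - q))\<^sup>2 \<le> \<psi> p q \<and> \<psi> p q \<le> \<Lambda> * (norm (p - q))\<^sup>2"
    and "(\<lambda>(x, y). K x y) \<in> borel_measurable (lebesgue_on (\<Omega> \<times> \<Omega>))"
    and "AE (x, y) in lebesgue_on (\<Omega> \<times> \<Omega>). ennreal (1 / \<Lambda>) * j (x - y) \<le> K x y"
    and "\<And>k. m_seq k \<in> X_space \<Omega> K N"
    and "(SUP k. F_energy \<Omega> K \<psi> (m_seq k)) < \<infinity>"
  shows "\<exists>(r :: nat \<Rightarrow> nat) m. strict_mono r \<and> m \<in> X_space \<Omega> K N \<and>
           (\<lambda>h. L2_norm_on \<Omega> (\<lambda>x. m_seq (r h) x - m x)) \<longlonglongrightarrow> 0"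
proof -
  note bounded = assms(1) and op = assms(2) and compact = assms(3) and j = assms(4)
    and inf = assms(7) and \<Lambda> = assms(8) and \<psi>_bounds = assms(11)
    and K = assms(12) and K_ge = assms(13) and m_seq = assms(14) and sup = assms(15)
  have \<Omega>_borel: "\<Omega> \<in> sets borel"
    using op by (rule borel_open)
  have finite_\<Omega>: "finite_measure (lebesgue_on \<Omega>)"
    using bounded op by (intro finite_measure_lebesgue_on) (simp add: lmeasurable_open)
  obtain B where B: "\<And>p. p \<in> N \<Longrightarrow> norm p \<le> B" "0 < B"
    using compact_imp_bounded[OF compact] unfolding bounded_pos by blast
  have m_meas: "m_seq k \<in> borel_measurable (lebesgue_on \<Omega>)"
      and m_N: "AE x in lebesgue_on \<Omega>. m_seq k x \<in> N" for k
    using m_seq[of k] by (auto simp: X_space_def L2_maps_def)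
  have "\<exists>u\<in>borel_measurable borel. (\<forall>x. norm (u x) \<le> B) \<and> (AE x in lebesgue_on \<Omega>. m_seq k x = u x)" for k
  proof -
    obtain g where g[measurable]: "g \<in> borel_measurable borel"
        and eq: "AE x in lebesgue_on \<Omega>. m_seq k x = g x"
      using lebesgue_on_borel_representative[OF \<Omega>_borel m_meas] by blast
    define u where "u x = (if norm (g x) \<le> B then g x else 0)" for x
    have "u \<in> borel_measurable borel"
      unfolding u_def by measurable
    moreover have "norm (u x) \<le> B" for x
      using B(2) by (simp add: u_def)
    moreover have "AE x in lebesgue_on \<Omega>. m_seq k x = u x"
      using eq m_N[of k] by eventually_elim (auto simp: u_def dest: B(1))
    ultimately show ?thesis by blast
  qed
  then obtain u where u[measurable]: "\<And>k. u k \<in> borel_measurable borel"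
    and u_bdd: "\<And>k x. norm (u k x) \<le> B" and m_u: "\<And>k. AE x in lebesgue_on \<Omega>. m_seq k x = u k x"
    by metis
  have u_lebesgue: "f \<in> borel_measurable (lebesgue_on A)" if "f \<in> borel_measurable borel"
    for f :: "'c::euclidean_space \<Rightarrow> 'd::topological_space" and A
    using that by (intro measurable_restrict_space1 measurable_completion) simp
  obtain C where C: "\<And>k. F_energy \<Omega> K \<psi> (m_seq k) \<le> ennreal C" "0 \<le> C"
  proof -
    obtain C where "(SUP k. F_energy \<Omega> K \<psi> (m_seq k)) = ennreal C" "0 \<le> C"
      using sup by (cases "SUP k. F_energy \<Omega> K \<psi> (m_seq k)") auto
    then show ?thesis
      using that[of C] SUP_upper[of _ UNIV "\<lambda>k. F_energy \<Omega> K \<psi> (m_seq k)"] by auto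
  qed
  have K_meas: "(\<lambda>z. case z of (x, y) \<Rightarrow> K x y * ennreal ((norm (v x - v y))\<^sup>2))
      \<in> borel_measurable (lebesgue_on (\<Omega> \<times> \<Omega>))"
    if "v \<in> borel_measurable borel" for v :: "real^'n \<Rightarrow> real^'l"
  proof -
    note that[measurable]
    have "(\<lambda>z. ennreal ((norm (v (fst z) - v (snd z)))\<^sup>2)) \<in> borel_measurable (borel \<Otimes>\<^sub>M borel)"
      by measurable
    then have "(\<lambda>z. ennreal ((norm (v (fst z) - v (snd z)))\<^sup>2))
        \<in> borel_measurable (lebesgue_on (\<Omega> \<times> \<Omega>))"
      by (intro u_lebesgue) (simp add: borel_prod)
    from borel_measurable_times_ennreal[OF K this] show ?thesis
      by (simp add: case_prod_unfold)
  qed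
  have \<Lambda>_cancel: "ennreal \<Lambda> * (ennreal (1 / \<Lambda>) * a) = a" for a
    using \<Lambda> by (simp flip: mult.assoc ennreal_mult)
  have K_u: "K_energy \<Omega> K (u k) \<le> ennreal \<Lambda> * ennreal C" for k
  proof -
    have "ennreal (1 / \<Lambda>) * K_energy \<Omega> K (u k)
        = (\<integral>\<^sup>+z. ennreal (1 / \<Lambda>) * (case z of (x, y) \<Rightarrow> K x y * ennreal ((norm (u k x - u k y))\<^sup>2))
            \<partial>lebesgue_on (\<Omega> \<times> \<Omega>))"
      unfolding K_energy_def by (intro nn_integral_cmult[symmetric] K_meas u)
    also have "\<dots> \<le> F_energy \<Omega> K \<psi> (m_seq k)"
      unfolding F_energy_def
    proof (rule nn_integral_mono_AE)
      have "AE x in lebesgue_on \<Omega>. m_seq k x \<in> N \<and> m_seq k x = u k x"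
        using m_N[of k] m_u[of k] by eventually_elim simp
      from AE_lebesgue_on_Times[OF op this]
      show "AE z in lebesgue_on (\<Omega> \<times> \<Omega>).
          ennreal (1 / \<Lambda>) * (case z of (x, y) \<Rightarrow> K x y * ennreal ((norm (u k x - u k y))\<^sup>2))
          \<le> (case z of (x, y) \<Rightarrow> K x y * ennreal (\<psi> (m_seq k x) (m_seq k y)))"
      proof (rule eventually_mono, clarify)
        fix x y
        assume N: "m_seq k x \<in> N" "m_seq k y \<in> N" and eq: "m_seq k x = u k x" "m_seq k y = u k y"
        have "ennreal (1 / \<Lambda>) * ennreal ((norm (u k x - u k y))\<^sup>2)
            \<le> ennreal (\<psi> (m_seq k x) (m_seq k y))"
          using \<psi>_bounds[OF N] \<Lambda> unfolding eq by (simp add: ennreal_leI flip: ennreal_mult)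
        then have "K x y * (ennreal (1 / \<Lambda>) * ennreal ((norm (u k x - u k y))\<^sup>2))
            \<le> K x y * ennreal (\<psi> (m_seq k x) (m_seq k y))"
          by (rule mult_left_mono) simp
        then show "ennreal (1 / \<Lambda>) * (K x y * ennreal ((norm (u k x - u k y))\<^sup>2))
            \<le> K x y * ennreal (\<psi> (m_seq k x) (m_seq k y))"
          by (simp add: ac_simps)
      qed
    qed
    also have "\<dots> \<le> ennreal C"
      by (rule C)
    finally have "ennreal \<Lambda> * (ennreal (1 / \<Lambda>) * K_energy \<Omega> K (u k)) \<le> ennreal \<Lambda> * ennreal C"
      by (rule mult_left_mono) simp
    then show ?thesis
      by (simp only: \<Lambda>_cancel)
  qed
  define M where "M = density lborel (indicator \<Omega> :: real^'n \<Rightarrow> ennreal)"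
  have AE_M: "(AE x in M. P x) \<longleftrightarrow> (AE x in lebesgue_on \<Omega>. P x)" for P
    unfolding M_def using \<Omega>_borel by (simp add: AE_density AE_lebesgue_on_iff indicator_def)
  have energy: "(\<integral>\<^sup>+x. \<integral>\<^sup>+y. j (x - y) * ennreal ((norm (u k x - u k y))\<^sup>2) \<partial>M \<partial>M)
      \<le> ennreal (\<Lambda> * (\<Lambda> * C))" for k
  proof -
    have "(\<lambda>(x, y). j (x - y) * ennreal ((norm (u k x - u k y))\<^sup>2)) \<in> borel_measurable (borel \<Otimes>\<^sub>M borel)"
      using j by measurable
    then have "(\<integral>\<^sup>+x. \<integral>\<^sup>+y. j (x - y) * ennreal ((norm (u k x - u k y))\<^sup>2) \<partial>M \<partial>M)
      = (\<integral>\<^sup>+(x, y). j (x - y) * ennreal ((norm (u k x - u k y))\<^sup>2) \<partial>lebesgue_on (\<Omega> \<times> \<Omega>))"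
      unfolding M_def by (intro nn_integral_lebesgue_on_Times[symmetric] op) (simp add: borel_prod)
    also have "\<dots> \<le> (\<integral>\<^sup>+z. ennreal \<Lambda> * (case z of (x, y) \<Rightarrow> K x y * ennreal ((norm (u k x - u k y))\<^sup>2))
        \<partial>lebesgue_on (\<Omega> \<times> \<Omega>))"
    proof (rule nn_integral_mono_AE, rule eventually_mono[OF K_ge], clarify)
      fix x y assume "ennreal (1 / \<Lambda>) * j (x - y) \<le> K x y"
      then have "ennreal \<Lambda> * (ennreal (1 / \<Lambda>) * j (x - y)) \<le> ennreal \<Lambda> * K x y"
        by (rule mult_left_mono) simp
      then have "j (x - y) \<le> ennreal \<Lambda> * K x y"
        by (simp only: \<Lambda>_cancel)
      then show "j (x - y) * ennreal ((norm (u k x - u k y))\<^sup>2)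
          \<le> ennreal \<Lambda> * (K x y * ennreal ((norm (u k x - u k y))\<^sup>2))"
        unfolding mult.assoc[symmetric] by (rule mult_right_mono) simp
    qed
    also have "\<dots> = ennreal \<Lambda> * K_energy \<Omega> K (u k)"
      unfolding K_energy_def by (intro nn_integral_cmult K_meas u)
    also have "\<dots> \<le> ennreal \<Lambda> * (ennreal \<Lambda> * ennreal C)"
      by (intro mult_left_mono K_u) simp
    also have "\<dots> = ennreal (\<Lambda> * (\<Lambda> * C))"
      using \<Lambda> C by (simp add: ennreal_mult)
    finally show ?thesis .
  qed
  obtain r where r: "strict_mono r" and "AE x in M. convergent (\<lambda>h. u (r h) x)"
    by (rule nonlocal_energy_AE_subseq[OF bounded op j inf u u_bdd energy[unfolded M_def], folded M_def])
  then have conv: "AE x in lebesgue_on \<Omega>. convergent (\<lambda>h. u (r h) x)"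
    by (simp add: AE_M)
  define m where "m x = lim (\<lambda>h. u (r h) x)" for x
  have m[measurable]: "m \<in> borel_measurable borel"
    unfolding m_def by measurable
  have lim: "AE x in lebesgue_on \<Omega>. (\<lambda>h. u (r h) x) \<longlonglongrightarrow> m x"
    using conv by eventually_elim (simp add: m_def convergent_LIMSEQ_iff)
  have m_bdd: "AE x in lebesgue_on \<Omega>. norm (m x) \<le> B"
    using lim by eventually_elim (rule Lim_norm_ubound, auto simp: u_bdd)
  have "AE x in lebesgue_on \<Omega>. \<forall>k. m_seq k x \<in> N \<and> m_seq k x = u k x"
    unfolding AE_all_countable
  proof
    fix k show "AE x in lebesgue_on \<Omega>. m_seq k x \<in> N \<and> m_seq k x = u k x"
      using m_N[of k] m_u[of k] by eventually_elim simp
  qed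
  then have m_in_N: "AE x in lebesgue_on \<Omega>. m x \<in> N"
    using lim
  proof eventually_elim
    fix x assume "\<forall>k. m_seq k x \<in> N \<and> m_seq k x = u k x" and l: "(\<lambda>h. u (r h) x) \<longlonglongrightarrow> m x"
    then have "u (r h) x \<in> N" for h
      by metis
    then show "m x \<in> N"
      using closed_sequentially[OF compact_imp_closed[OF compact] _ l] by blast
  qed
  have "K_energy \<Omega> K m \<le> (\<integral>\<^sup>+z. liminf (\<lambda>h. case z of (x, y) \<Rightarrow> K x y * ennreal ((norm (u (r h) x - u (r h) y))\<^sup>2))
      \<partial>lebesgue_on (\<Omega> \<times> \<Omega>))"
    unfolding K_energy_def
  proof (rule nn_integral_mono_AE, rule eventually_mono[OF AE_lebesgue_on_Times[OF op lim]], clarify)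
    fix x y assume "(\<lambda>h. u (r h) x) \<longlonglongrightarrow> m x" "(\<lambda>h. u (r h) y) \<longlonglongrightarrow> m y"
    then have "(\<lambda>h. ennreal ((norm (u (r h) x - u (r h) y))\<^sup>2)) \<longlonglongrightarrow> ennreal ((norm (m x - m y))\<^sup>2)"
      by (intro tendsto_ennrealI tendsto_intros)
    then show "K x y * ennreal ((norm (m x - m y))\<^sup>2)
        \<le> liminf (\<lambda>h. K x y * ennreal ((norm (u (r h) x - u (r h) y))\<^sup>2))"
      by (rule cmult_le_liminf_ennreal)
  qed
  also have "\<dots> \<le> liminf (\<lambda>h. K_energy \<Omega> K (u (r h)))"
    unfolding K_energy_def by (rule nn_integral_liminf) (rule K_meas[OF u])
  also have "\<dots> \<le> ennreal \<Lambda> * ennreal C"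
    by (intro Liminf_le always_eventually allI K_u) simp
  also have "\<dots> < \<infinity>"
    by (simp add: ennreal_mult_less_top)
  finally have "K_energy \<Omega> K m < \<infinity>" .
  moreover have "integrable (lebesgue_on \<Omega>) (\<lambda>x. (norm (m x))\<^sup>2)"
    by (rule finite_measure.integrable_const_bound[OF finite_\<Omega>, of _ "B\<^sup>2"])
      (use m_bdd in \<open>auto intro!: u_lebesgue power_mono elim!: eventually_mono\<close>)
  ultimately have "m \<in> X_space \<Omega> K N"
    using m_in_N u_lebesgue[OF m] by (simp add: X_space_def L2_maps_def)
  moreover have "(\<lambda>h. L2_norm_on \<Omega> (\<lambda>x. m_seq (r h) x - m x)) \<longlonglongrightarrow> 0"
  proof -
    have "(\<lambda>h. \<integral>x. (norm (m_seq (r h) x - m x))\<^sup>2 \<partial>lebesgue_on \<Omega>) \<longlonglongrightarrow> (\<integral>x. 0 \<partial>lebesgue_on \<Omega>)"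
    proof (rule integral_dominated_convergence[where w = "\<lambda>_. (2 * B)\<^sup>2"])
      show "(\<lambda>x. (norm (m_seq (r h) x - m x))\<^sup>2) \<in> borel_measurable (lebesgue_on \<Omega>)" for h
        using m_meas[of "r h"] u_lebesgue[OF m] by simp
      show "integrable (lebesgue_on \<Omega>) (\<lambda>_. (2 * B)\<^sup>2)"
        using finite_measure.integrable_const[OF finite_\<Omega>] .
      have m_u_all: "AE x in lebesgue_on \<Omega>. \<forall>k. m_seq k x = u k x"
        unfolding AE_all_countable using m_u by blast
      from this lim show "AE x in lebesgue_on \<Omega>. (\<lambda>h. (norm (m_seq (r h) x - m x))\<^sup>2) \<longlonglongrightarrow> 0"
      proof eventually_elim
        fix x assume eq: "\<forall>k. m_seq k x = u k x" and l: "(\<lambda>h. u (r h) x) \<longlonglongrightarrow> m x"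
        have "(\<lambda>h. (norm (u (r h) x - m x))\<^sup>2) \<longlonglongrightarrow> (norm (m x - m x))\<^sup>2"
          by (intro tendsto_intros l)
        then show "(\<lambda>h. (norm (m_seq (r h) x - m x))\<^sup>2) \<longlonglongrightarrow> 0"
          using eq by simp
      qed
      show "AE x in lebesgue_on \<Omega>. norm ((norm (m_seq (r h) x - m x))\<^sup>2) \<le> (2 * B)\<^sup>2" for h
        using m_u_all m_bdd
      proof eventually_elim
        fix x assume eq: "\<forall>k. m_seq k x = u k x" and "norm (m x) \<le> B"
        then have "norm (m_seq (r h) x - m x) \<le> 2 * B"
          using norm_triangle_ineq4[of "u (r h) x" "m x"] u_bdd[of "r h" x] by simp
        then have "(norm (m_seq (r h) x - m x))\<^sup>2 \<le> (2 * B)\<^sup>2"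
          by (rule power_mono) simp
        then show "norm ((norm (m_seq (r h) x - m x))\<^sup>2) \<le> (2 * B)\<^sup>2"
          by simp
      qed
    qed simp
    then have "(\<lambda>h. sqrt (\<integral>x. (norm (m_seq (r h) x - m x))\<^sup>2 \<partial>lebesgue_on \<Omega>)) \<longlonglongrightarrow> sqrt 0"
      by (intro tendsto_real_sqrt) simp
    then show ?thesis
      by (simp add: L2_norm_on_def)
  qed
  ultimately show ?thesis
    using r by blast
qed

end
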